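(* Let $P(\lambda)=\sum_{i=0}^dP_i\lambda^i\in\mathbb F[\lambda]^{m\times n}$ be a singular matrix polynomial with $d=k\ell$, for some $k$. Let $$\mathcal L(\lambda)=\left[\begin{array}{c|c}M(\lambda)&L_\eta(\lambda^\ell)^T\otimes I_m\\\hline L_\epsilon(\lambda^\ell)\otimes I_n&0\end{array}\right]$$ be an $(\epsilon,n,\eta,m)$-block Kronecker degree-$\ell$ matrix polynomial with $k=\epsilon+\eta+1$ such that $P(\lambda)=(\Lambda_\eta(\lambda^\ell)^T\otimes I_m)M(\lambda)(\Lambda_\epsilon(\lambda^\ell)\otimes I_n)$. Consider $\mathcal L(\lambda)$ partitioned into $k\times k$ blocks whose sizes are fixed by the size $n\times n$ of the blocks of $L_\epsilon(\lambda^\ell)\otimes I_n$ and the size $m\times m$ of the blocks of $L_\eta(\lambda^\ell)^T\otimes I_m$ (so the block columns consist of $\epsilon+1$ blocks of width $n$ followed by $\eta$ blocks of width $m$, and the block rows consist of $\eta+1$ blocks of height $m$ followed by $\epsilon$ blocks of height $n$). Then: (a) If $\{z_1(\lambda),z_2(\lambda),\dots,z_p(\lambda)\}$ is any right minimal basis of $\mathcal L(\lambda)$ whose vectors are partitioned into blocks conformable to the block columns of $\mathcal L(\lambda)$, and if $x_j(\lambda)$ is the $(\epsilon+1)$th block of $z_j(\lambda)$, for $j=1,2,\dots,p$, then $\{x_1(\lambda),x_2(\lambda),\dots,x_p(\lambda)\}$ is a right minimal basis of $P(\lambda)$. (b) If $\{w_1(\lambda)^T,w_2(\lambda)^T,\dots,w_q(\lambda)^T\}$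 is any left minimal basis of $\mathcal L(\lambda)$ whose vectors are partitioned into blocks conformable to the block rows of $\mathcal L(\lambda)$, and if $y_j(\lambda)^T$ is the $(\eta+1)$th block of $w_j(\lambda)^T$, for $j=1,2,\dots,q$, then $\{y_1(\lambda)^T,y_2(\lambda)^T,\dots,y_q(\lambda)^T\}$ is a left minimal basis of $P(\lambda)$.
   Context: $\mathbb F$ is an arbitrary field. A matrix polynomial is regular if it is square with determinant not identically zero, and singular otherwise. A matrix polynomial has grade $g$ if it can be written $\sum_{i=0}^gP_i\lambda^i$ (coefficients possibly zero). $L_k(\lambda)\in\mathbb F[\lambda]^{k\times(k+1)}$ is the bidiagonal pencil with $(i,i)$ entries $-1$, $(i,i+1)$ entries $\lambda$ and other entries $0$. $\Lambda_k(\lambda)^T:=\begin{bmatrix}\lambda^k&\cdots&\lambda&1\end{bmatrix}\in\mathbb F[\lambda]^{1\times(k+1)}$. $L_k(\lambda^\ell),\Lambda_k(\lambda^\ell)$ denote these evaluated at $\lambda^\ell$. $\otimes$ is the Kronecker product. An $(\epsilon,n,\eta,m)$-block Kronecker degree-$\ell$ matrix polynomial ($\ell\ge1$, $\epsilon,\eta\ge0$ integers) is a matrix polynomial of the displayed form with $M(\lambda)$ an arbitrary $(\eta+1)m\times(\epsilon+1)n$ matrix polynomial of grade $\ell$; if $\epsilon=0$ (resp. $\eta=0$) the second block row (resp. column) is absent. A minimal basis of a subspace of $\mathbb F(\lambda)^q$ is a basis of vector polynomials with least sum of degrees among all bases of vector polynomials. A right (left) minimal basis of a matrix polynomial $P(\lambda)$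 is a minimal basis of the $\mathbb F(\lambda)$-space $\{x(\lambda):P(\lambda)x(\lambda)=0\}$ (of $\{y(\lambda)^T:y(\lambda)^TP(\lambda)=0\}$). *)

theory Defs
  imports
    "Jordan_Normal_Form.Matrix_Kernel"
    "HOL-Computational_Algebra.Polynomial_Factorial"
begin

text \<open>A matrix polynomial over a field \<open>'a\<close> is an element of type \<open>'a poly mat\<close>; the field of
  rational functions is \<open>'a poly fract\<close>, with canonical embedding \<^const>\<open>to_fract\<close>. Both row and
  column vectors are represented by the type \<open>vec\<close>.\<close>

definition regular_poly_mat :: "'a::field poly mat \<Rightarrow> bool" where
  "regular_poly_mat P \<longleftrightarrow> dim_row P = dim_col P \<and> det P \<noteq> 0"

abbreviation singular_poly_mat :: "'a::field poly mat \<Rightarrow> bool" where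
  "singular_poly_mat P \<equiv> \<not> regular_poly_mat P"

text \<open>The coefficients, including the one of index \<open>g\<close>, may be zero.\<close>

definition has_grade :: "nat \<Rightarrow> 'a::field poly mat \<Rightarrow> bool" where
  "has_grade g P \<longleftrightarrow>
    (\<exists>C :: nat \<Rightarrow> 'a mat.
      (\<forall>i\<le>g. C i \<in> carrier_mat (dim_row P) (dim_col P)) \<and>
      P = mat (dim_row P) (dim_col P) (\<lambda>rc. \<Sum>i\<le>g. monom (C i $$ rc) i))"

definition kronecker_prod :: "'a::semiring_0 mat \<Rightarrow> 'a mat \<Rightarrow> 'a mat" (infixl "\<otimes>\<^sub>m" 75) where
  "A \<otimes>\<^sub>m B = mat (dim_row A * dim_row B) (dim_col A * dim_col B)
     (\<lambda>(i, j). A $$ (i div dim_row B, j div dim_col B) * B $$ (i mod dim_row B, j mod dim_col B))"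

definition L_pencil :: "nat \<Rightarrow> 'a::field poly mat" where
  "L_pencil k = mat k (k + 1) (\<lambda>(i, j). if j = i then -1 else if j = i + 1 then [:0, 1:] else 0)"

text \<open>The column of the powers \<open>\<lambda>\<^sup>k, \<dots>, \<lambda>, 1\<close>, in this order.\<close>

definition Lambda_col :: "nat \<Rightarrow> 'a::field poly mat" where
  "Lambda_col k = mat (k + 1) 1 (\<lambda>(i, j). monom 1 (k - i))"

text \<open>Substitution of \<open>\<lambda>\<^sup>l\<close> for \<open>\<lambda>\<close>.\<close>

definition at_power :: "'a::field poly mat \<Rightarrow> nat \<Rightarrow> 'a poly mat" where
  "at_power A l = map_mat (\<lambda>p. pcompose p (monom 1 l)) A"

text \<open>For \<open>e = 0\<close> (resp. \<open>h = 0\<close>) the second block row (resp. column) has height (resp. width)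
  zero, i.e. it is absent.\<close>

definition block_kronecker ::
  "nat \<Rightarrow> nat \<Rightarrow> nat \<Rightarrow> nat \<Rightarrow> nat \<Rightarrow> 'a::field poly mat \<Rightarrow> 'a poly mat \<Rightarrow> bool" where
  "block_kronecker e n h m l M L \<longleftrightarrow>
    1 \<le> l \<and> M \<in> carrier_mat ((h + 1) * m) ((e + 1) * n) \<and> has_grade l M \<and>
    L = four_block_mat
          M                                    (transpose_mat (at_power (L_pencil h) l) \<otimes>\<^sub>m 1\<^sub>m m)
          (at_power (L_pencil e) l \<otimes>\<^sub>m 1\<^sub>m n)  (0\<^sub>m (e * n) (h * m))"

text \<open>Degree of a vector polynomial: the largest degree of an entry. Inserting \<open>0\<close> only matters
  for vectors of dimension zero.\<close>

definition vec_degree :: "'a::field poly vec \<Rightarrow> nat" where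
  "vec_degree v = Max (insert 0 {degree (v $ i) | i. i < dim_vec v})"

text \<open>A list of vector polynomials, without repetitions, that forms a basis of the subspace \<open>W\<close> of
  the \<open>q\<close>-dimensional vector space over the field of rational functions.\<close>

definition polynomial_basis ::
  "nat \<Rightarrow> 'a::field poly fract vec set \<Rightarrow> 'a poly vec list \<Rightarrow> bool" where
  "polynomial_basis q W zs \<longleftrightarrow>
    set zs \<subseteq> carrier_vec q \<and> distinct zs \<and>
    vectorspace.basis class_ring (module_vec TYPE('a poly fract) q\<lparr>carrier := W\<rparr>)
      (map_vec to_fract ` set zs)"

definition minimal_basis ::
  "nat \<Rightarrow> 'a::field poly fract vec set \<Rightarrow> 'a poly vec list \<Rightarrow> bool" where
  "minimal_basis q W zs \<longleftrightarrow>
    polynomial_basis q W zs \<and>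
    (\<forall>ys. polynomial_basis q W ys \<longrightarrow> (\<Sum>z\<leftarrow>zs. vec_degree z) \<le> (\<Sum>y\<leftarrow>ys. vec_degree y))"

definition right_minimal_basis :: "'a::field poly mat \<Rightarrow> 'a poly vec list \<Rightarrow> bool" where
  "right_minimal_basis P = minimal_basis (dim_col P) (mat_kernel (map_mat to_fract P))"

definition left_null_space :: "'a::comm_ring_1 mat \<Rightarrow> 'a vec set" where
  "left_null_space A =
    {y \<in> carrier_vec (dim_row A). mat_of_row y * A = 0\<^sub>m 1 (dim_col A)}"

definition left_minimal_basis :: "'a::field poly mat \<Rightarrow> 'a poly vec list \<Rightarrow> bool" where
  "left_minimal_basis P = minimal_basis (dim_row P) (left_null_space (map_mat to_fract P))"

text \<open>The block with index \<open>i\<close>, counted from \<open>0\<close>, of a vector partitioned into consecutive blocks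
  whose sizes are given by \<open>ss\<close>.\<close>

definition vec_block :: "nat list \<Rightarrow> 'a vec \<Rightarrow> nat \<Rightarrow> 'a vec" where
  "vec_block ss v i = vec (ss ! i) (\<lambda>j. v $ (sum_list (take i ss) + j))"

definition block_col_sizes :: "nat \<Rightarrow> nat \<Rightarrow> nat \<Rightarrow> nat \<Rightarrow> nat list" where
  "block_col_sizes e n h m = replicate (e + 1) n @ replicate h m"

definition block_row_sizes :: "nat \<Rightarrow> nat \<Rightarrow> nat \<Rightarrow> nat \<Rightarrow> nat list" where
  "block_row_sizes e n h m = replicate (h + 1) m @ replicate e n"

end

theory Submission
  imports Defs
begin

text \<open>
  The theorem rests on a linear isomorphism between the right kernels of \<open>L\<close> and \<open>P\<close> that respects
  polynomial vectors and changes degrees by a constant.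

  Write a vector as \<open>z = u @\<^sub>v v\<close> along the two block columns, and let \<open>t\<close> be the \<open>l\<close>-th power of the
  variable.  The bottom block row of \<open>L z = 0\<close> says that each block of \<open>u\<close> is \<open>t\<close> times the next one,
  so that \<open>u\<close> consists of the multiples of its last block \<open>x\<close> by the powers of \<open>t\<close>.  The top block row
  is \<open>M u + (N \<otimes> 1) v = 0\<close>, where \<open>N\<close> is lower bidiagonal with \<open>-1\<close> on the diagonal and \<open>t\<close> below it.
  Solved from the top, it gives \<open>v\<close> as Horner sums of the blocks of \<open>M u\<close>, and its last row then says
  that the complete Horner sum vanishes, which is \<open>P x = 0\<close>.  No division occurs, so \<open>z \<mapsto> x\<close> is a bijection of kernels over every commutative
  ring: over the rational functions, and also between the polynomial vectors
  (\<open>kernel_lift_mem_kernel\<close>, \<open>last_block_mem_kernel\<close>).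

  For degrees, \<open>u\<close> has degree \<open>e * l + deg x\<close>, where \<open>e\<close> is the \<open>\<epsilon>\<close> of the theorem.  The degree of \<open>M u\<close>
  is larger by at most \<open>l\<close>, and reading the top block row from the bottom, each block of \<open>t v\<close> is a
  difference of vectors of degree at most \<open>deg u + l\<close>.  Thus \<open>v\<close> does not exceed the degree of \<open>u\<close>, and
  \<open>deg z = e * l + deg x\<close> (\<open>vec_degree_kernel_lift\<close>).

  All bases of a kernel have equally many elements, so a constant degree shift moves the degree sums of
  all polynomial bases by one and the same amount and preserves minimality
  (\<open>minimal_basis_transfer\<close>).  The statement on left minimal bases is the one on right minimal bases
  for the transposed matrices, which are again block Kronecker matrices with \<open>(\<epsilon>, n)\<close> and \<open>(\<eta>, m)\<close>
  exchanged.
\<close>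

section \<open>Minimal bases under isomorphisms of kernels\<close>

lemma vectorspace_kernel:
  fixes A :: "'b::field mat"
  assumes A: "A \<in> carrier_mat r q"
  shows "vectorspace class_ring (module_vec TYPE('b) q\<lparr>carrier := mat_kernel A\<rparr>)"
proof -
  interpret KA: kernel r q A by (rule kernel.intro[OF A])
  show ?thesis by (rule KA.Ker.vectorspace_axioms)
qed

text \<open>Linear independence and spanning are carried over by an isomorphism.  Additivity and homogeneity are
  asked for on the kernel only, so that the inverse of \<open>F\<close>, which is meaningful only there, qualifies
  as well.\<close>

lemma kernel_basis_linear_image:
  fixes A B :: "'b::field mat"
  assumes A: "A \<in> carrier_mat ra qa" and B: "B \<in> carrier_mat rb qb"
    and bij: "bij_betw F (mat_kernel A) (mat_kernel B)"
    and add: "\<And>u v. u \<in> mat_kernel A \<Longrightarrow> v \<in> mat_kernel A \<Longrightarrow> F (u + v) = F u + F v"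
    and smult: "\<And>c v. v \<in> mat_kernel A \<Longrightarrow> F (c \<cdot>\<^sub>v v) = c \<cdot>\<^sub>v F v"
    and S: "kernel.basis qa A S"
  shows "kernel.basis qb B (F ` S)"
proof -
  interpret KA: kernel ra qa A by (rule kernel.intro[OF A])
  let ?VB = "module_vec TYPE('b) qb\<lparr>carrier := mat_kernel B\<rparr>"
  have vsB: "vectorspace class_ring ?VB"
    by (rule vectorspace_kernel[OF B])
  have "F v \<in> mat_kernel B" if "v \<in> mat_kernel A" for v
    using bij that by (auto simp: bij_betw_def)
  then have "F \<in> LinearCombinations.module_hom class_ring KA.VK ?VB"
    by (simp add: LinearCombinations.module_hom_def add smult module_vec_simps)
  then have T: "linear_map class_ring KA.VK ?VB F"
    by (intro linear_map.intro mod_hom.intro mod_hom_axioms.intro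
        KA.Ker.vectorspace_axioms vsB vectorspace.axioms)
  obtain C where "finite C" "KA.basis C"
    using kernel_basis_exists[OF A] by blast
  then have "KA.Ker.fin_dim"
    by (auto simp: KA.Ker.fin_dim_def KA.Ker.basis_def)
  with bij S show ?thesis
    by (intro linear_map.linear_inj_image_is_basis[OF T]) (auto simp: bij_betw_def)
qed

lemma kernel_bases_same_card:
  fixes A :: "'b::field mat"
  assumes A: "A \<in> carrier_mat r q"
    and "kernel.basis q A S" "finite S" "kernel.basis q A S'" "finite S'"
  shows "card S = card S'"
proof -
  interpret KA: kernel r q A by (rule kernel.intro[OF A])
  show ?thesis using assms KA.Ker.dim_basis by metis
qed

lemma map_vec_to_fract_inject:
  "map_vec to_fract u = map_vec to_fract v \<longleftrightarrow> u = (v :: 'a::field poly vec)"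
  by (auto simp: vec_eq_iff)

lemma polynomial_basis_kernel_iff:
  fixes A :: "'a::field poly mat"
  shows "polynomial_basis q (mat_kernel (map_mat to_fract A)) zs \<longleftrightarrow>
    set zs \<subseteq> carrier_vec q \<and> distinct zs \<and>
    kernel.basis q (map_mat to_fract A) (map_vec to_fract ` set zs)"
  by (simp add: polynomial_basis_def)

lemma basis_subset_kernel:
  fixes A :: "'b::field mat"
  assumes A: "A \<in> carrier_mat r q" and S: "kernel.basis q A S"
  shows "S \<subseteq> mat_kernel A" "0\<^sub>v q \<notin> S"
proof -
  interpret KA: kernel r q A by (rule kernel.intro[OF A])
  show "S \<subseteq> mat_kernel A" using S by (auto simp: KA.Ker.basis_def)
  with S show "0\<^sub>v q \<notin> S" using KA.Ker.vs_zero_lin_dep by (auto simp: KA.Ker.basis_def)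
qed

text \<open>A linear isomorphism \<open>F\<close> of rational kernels that restricts to a bijection between their
  polynomial vectors (\<open>f\<close>, with inverse \<open>g\<close>) carries polynomial bases to polynomial bases in both
  directions.  All bases of a kernel have the same number \<open>p\<close> of elements, so if \<open>f\<close> lowers all
  degrees by the same amount \<open>c\<close>, then it lowers the degree sum of every polynomial basis by the
  same amount \<open>c * p\<close>, and minimality is preserved.\<close>

lemma minimal_basis_transfer:
  fixes A B :: "'a::field poly mat" and f g :: "'a poly vec \<Rightarrow> 'a poly vec"
  defines "KA \<equiv> mat_kernel (map_mat to_fract A)" and "KB \<equiv> mat_kernel (map_mat to_fract B)"
  assumes A: "A \<in> carrier_mat ra qa" and B: "B \<in> carrier_mat rb qb"
    and bij: "bij_betw F KA KB"
    and add: "\<And>u v. u \<in> KA \<Longrightarrow> v \<in> KA \<Longrightarrow> F (u + v) = F u + F v"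
    and smult: "\<And>c v. v \<in> KA \<Longrightarrow> F (c \<cdot>\<^sub>v v) = c \<cdot>\<^sub>v F v"
    and F: "\<And>z. z \<in> carrier_vec qa \<Longrightarrow> F (map_vec to_fract z) = map_vec to_fract (f z)"
    and g: "\<And>x. map_vec to_fract x \<in> KB \<Longrightarrow>
              g x \<in> carrier_vec qa \<and> map_vec to_fract (g x) \<in> KA \<and> f (g x) = x"
    and deg: "\<And>z. map_vec to_fract z \<in> KA \<Longrightarrow> z \<noteq> 0\<^sub>v qa \<Longrightarrow> vec_degree z = c + vec_degree (f z)"
    and zs: "minimal_basis qa KA zs"
  shows "minimal_basis qb KB (map f zs)"
proof -
  let ?h = "map_vec to_fract :: 'a poly vec \<Rightarrow> _"
  have hA: "map_mat to_fract A \<in> carrier_mat ra qa" and hB: "map_mat to_fract B \<in> carrier_mat rb qb"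
    using A B by auto
  have carr: "z \<in> carrier_vec qa" if "?h z \<in> KA" for z
    using that mat_kernelD(1)[OF hA] unfolding KA_def by fastforce
  have carrB: "z \<in> carrier_vec qb" if "?h z \<in> KB" for z
    using that mat_kernelD(1)[OF hB] unfolding KB_def by fastforce
  have fKB: "?h (f z) \<in> KB" if "?h z \<in> KA" for z
    using F[OF carr[OF that]] bij_betwE[OF bij] that by auto
  have f_inj: "z = z'" if "?h z \<in> KA" "?h z' \<in> KA" "f z = f z'" for z z'
  proof -
    have "F (?h z) = F (?h z')" using that(3) F carr[OF that(1)] carr[OF that(2)] by simp
    with that(1,2) have "?h z = ?h z'" using bij_betw_imp_inj_on[OF bij] by (simp add: inj_on_def)
    then show ?thesis by (simp add: map_vec_to_fract_inject)
  qed
  have gf: "g (f z) = z" if "?h z \<in> KA" for z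
    using that f_inj g[OF fKB[OF that]] by blast
  have elems: "?h z \<in> KA" "z \<noteq> 0\<^sub>v qa" if "polynomial_basis qa KA zs'" "z \<in> set zs'" for zs' z
  proof -
    from that have "kernel.basis qa (map_mat to_fract A) (?h ` set zs')"
      by (simp add: KA_def polynomial_basis_kernel_iff)
    note * = basis_subset_kernel[OF hA this]
    show "?h z \<in> KA" using * that(2) by (auto simp: KA_def)
    have "?h (0\<^sub>v qa) = 0\<^sub>v qa" by auto
    then show "z \<noteq> 0\<^sub>v qa" using *(2) that(2) by (metis image_eqI)
  qed
  have pbB: "polynomial_basis qb KB (map f zs')" if pb: "polynomial_basis qa KA zs'" for zs'
  proof -
    from pb have bas: "kernel.basis qa (map_mat to_fract A) (?h ` set zs')"
      and d: "distinct zs'"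
      by (simp_all add: KA_def polynomial_basis_kernel_iff)
    have "kernel.basis qb (map_mat to_fract B) (F ` ?h ` set zs')"
      by (rule kernel_basis_linear_image[OF hA hB bij[unfolded KA_def KB_def] _ _ bas])
        (use add smult in \<open>auto simp: KA_def\<close>)
    moreover have "F ` ?h ` set zs' = ?h ` set (map f zs')"
      unfolding set_map image_image using elems(1)[OF pb] carr F by (intro image_cong) auto
    moreover have "distinct (map f zs')"
      using d f_inj elems(1)[OF pb] by (auto simp: distinct_map inj_on_def)
    moreover have "set (map f zs') \<subseteq> carrier_vec qb"
      using fKB elems(1)[OF pb] carrB by auto
    ultimately show ?thesis by (simp add: KB_def polynomial_basis_kernel_iff)
  qed
  have pbA: "polynomial_basis qa KA (map g ys)" if pb: "polynomial_basis qb KB ys" for ys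
  proof -
    from pb have bas: "kernel.basis qb (map_mat to_fract B) (?h ` set ys)"
      and d: "distinct ys"
      by (simp_all add: KB_def polynomial_basis_kernel_iff)
    have y: "?h y \<in> KB" if "y \<in> set ys" for y
      using basis_subset_kernel(1)[OF hB bas] that by (auto simp: KB_def)
    \<comment> \<open>The inverse of \<open>F\<close> is linear too, so it carries bases back.\<close>
    define G where "G = inv_into KA F"
    have bijG: "bij_betw G KB KA" unfolding G_def by (rule bij_betw_inv_into[OF bij])
    have FG: "F (G v) = v" "G v \<in> KA" if "v \<in> KB" for v
      using that bij bijG by (auto simp: G_def bij_betw_inv_into_right dest: bij_betwE)
    have GF: "G (F v) = v" if "v \<in> KA" for v
      using that bij by (simp add: G_def bij_betw_inv_into_left)
    have KA_add: "u + v \<in> KA" if "u \<in> KA" "v \<in> KA" for u v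
      using that mult_add_distrib_mat_vec[OF hA] unfolding KA_def mat_kernel[OF hA] by auto
    have KA_smult: "k \<cdot>\<^sub>v v \<in> KA" if "v \<in> KA" for k v
      using that mat_kernel_smult[OF hA] unfolding KA_def by auto
    have "G (u + v) = G u + G v" if "u \<in> KB" "v \<in> KB" for u v
      using GF[OF KA_add[OF FG(2)[OF that(1)] FG(2)[OF that(2)]]] that by (simp add: add FG)
    moreover have "G (k \<cdot>\<^sub>v v) = k \<cdot>\<^sub>v G v" if "v \<in> KB" for k v
      using GF[OF KA_smult[OF FG(2)[OF that]]] that by (simp add: smult FG)
    ultimately have "kernel.basis qa (map_mat to_fract A) (G ` ?h ` set ys)"
      by (intro kernel_basis_linear_image[OF hB hA bijG[unfolded KA_def KB_def] _ _ bas])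
        (auto simp: KB_def)
    moreover have "G (?h y) = ?h (g y)" if "y \<in> set ys" for y
      using g[OF y[OF that]] F GF by metis
    then have "G ` ?h ` set ys = ?h ` set (map g ys)"
      unfolding set_map image_image by (intro image_cong) auto
    moreover have "distinct (map g ys)"
      using d g[OF y] by (auto simp: distinct_map intro: inj_on_inverseI[where g = f])
    moreover have "set (map g ys) \<subseteq> carrier_vec qa" using g[OF y] by auto
    ultimately show ?thesis by (simp add: KA_def polynomial_basis_kernel_iff)
  qed
  have deg_sum: "(\<Sum>z\<leftarrow>zs'. vec_degree z) = c * length zs' + (\<Sum>x\<leftarrow>map f zs'. vec_degree x)"
    if "polynomial_basis qa KA zs'" for zs'
  proof -
    have "(\<Sum>z\<leftarrow>zs'. vec_degree z) = (\<Sum>z\<leftarrow>zs'. c + vec_degree (f z))"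
      using deg elems[OF that] by (intro arg_cong[where f = sum_list] map_cong) auto
    then show ?thesis by (simp add: sum_list_addf sum_list_triv comp_def mult.commute)
  qed
  have pz: "polynomial_basis qa KA zs" using zs by (simp add: minimal_basis_def)
  have len: "length zs = length ys" if "polynomial_basis qa KA ys" for ys
  proof -
    have "card (?h ` set zs) = card (?h ` set ys)"
      by (rule kernel_bases_same_card[OF hA])
        (use pz that in \<open>auto simp: KA_def polynomial_basis_kernel_iff\<close>)
    moreover have "card (?h ` set xs) = length xs" if "polynomial_basis qa KA xs" for xs
      using that by (simp add: polynomial_basis_def card_image inj_on_def
          map_vec_to_fract_inject distinct_card)
    ultimately show ?thesis using pz that by simp
  qed
  show ?thesis unfolding minimal_basis_def
  proof (intro conjI allI impI)
    show "polynomial_basis qb KB (map f zs)" by (rule pbB[OF pz])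
    fix ys assume ys: "polynomial_basis qb KB ys"
    have "?h y \<in> KB" if "y \<in> set ys" for y
      using ys that basis_subset_kernel(1)[OF hB] by (auto simp: KB_def polynomial_basis_kernel_iff)
    then have "map f (map g ys) = ys" using g by (auto intro: map_idI)
    moreover have "(\<Sum>z\<leftarrow>zs. vec_degree z) \<le> (\<Sum>y\<leftarrow>map g ys. vec_degree y)"
      using zs pbA[OF ys] unfolding minimal_basis_def by blast
    ultimately show "(\<Sum>x\<leftarrow>map f zs. vec_degree x) \<le> (\<Sum>y\<leftarrow>ys. vec_degree y)"
      using deg_sum[OF pz] deg_sum[OF pbA[OF ys]] len[OF pbA[OF ys]] by simp
  qed
qed

section \<open>Kronecker products with an identity matrix and scalar recursions\<close>

lemma sum_lessThan_mult_blocks: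
  fixes f :: "nat \<Rightarrow> 'b::comm_monoid_add"
  shows "(\<Sum>k<c * n. f k) = (\<Sum>j<c. \<Sum>b<n. f (j * n + b))"
proof -
  have "(\<Sum>k<c * n. f k) = (\<Sum>j<c. \<Sum>k = j * n..<j * n + n. f k)"
    by (rule sum.nat_group[symmetric])
  also have "(\<lambda>j. \<Sum>k = j * n..<j * n + n. f k) = (\<lambda>j. \<Sum>b<n. f (j * n + b))"
  proof
    fix j
    show "(\<Sum>k = j * n..<j * n + n. f k) = (\<Sum>b<n. f (j * n + b))"
      using sum.shift_bounds_nat_ivl[of f 0 "j * n" n] by (simp add: lessThan_atLeast0 add.commute)
  qed
  finally show ?thesis .
qed

lemma block_index_less: "i < k \<Longrightarrow> a < n \<Longrightarrow> i * n + a < k * (n::nat)"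
  by (metis add.commute add_less_cancel_left mult_le_mono1 less_eq_Suc_le mult_Suc order_less_le_trans)

text \<open>Entry \<open>a\<close> of block \<open>i\<close> of a vector with blocks of length \<open>n\<close> has index \<open>i * n + a\<close>; every
  blockwise argument below uses this enumeration.\<close>

lemma all_less_mult_blocks:
  "(\<forall>j<k * n. Q j) \<longleftrightarrow> (\<forall>i<k. \<forall>a<n. Q (i * n + a :: nat))"
proof (safe)
  fix j assume *: "\<forall>i<k. \<forall>a<n. Q (i * n + a)" and j: "j < k * n"
  then have "n > 0" by (cases n) auto
  with j have "j div n < k" "j mod n < n" by (auto simp: div_less_iff_less_mult)
  with * have "Q (j div n * n + j mod n)" by blast
  then show "Q j" by simp
qed (simp add: block_index_less)

text \<open>Multiplication by \<open>A \<otimes>\<^sub>m 1\<^sub>m n\<close> lets \<open>A\<close> act on the sequence of blocks, separately for each position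
  \<open>a\<close> inside the blocks.  This reduces the block equations to scalar recursions.\<close>

lemma kronecker_one_mult_vec:
  fixes A :: "'b::comm_ring_1 mat"
  assumes "A \<in> carrier_mat r c" "u \<in> carrier_vec (c * n)" "i < r" "a < n"
  shows "((A \<otimes>\<^sub>m 1\<^sub>m n) *\<^sub>v u) $ (i * n + a) = (\<Sum>j<c. A $$ (i, j) * u $ (j * n + a))"
proof -
  have "((A \<otimes>\<^sub>m 1\<^sub>m n) *\<^sub>v u) $ (i * n + a) =
      (\<Sum>k<c * n. A $$ (i, k div n) * (1\<^sub>m n $$ (a, k mod n)) * u $ k)"
    using assms block_index_less[of i r a n]
    by (auto simp: kronecker_prod_def scalar_prod_def lessThan_atLeast0 intro!: sum.cong)
  also have "\<dots> = (\<Sum>j<c. \<Sum>b<n. if b = a then A $$ (i, j) * u $ (j * n + a) else 0)"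
    unfolding sum_lessThan_mult_blocks using assms by (intro sum.cong refl) auto
  also have "\<dots> = (\<Sum>j<c. A $$ (i, j) * u $ (j * n + a))"
    using assms by simp
  finally show ?thesis .
qed

text \<open>In this and the next three definitions, the substituted power of the variable is replaced by an
  element \<open>t\<close> of an arbitrary commutative ring, so that one kernel computation serves both the
  polynomials and the rational functions.\<close>

definition bidiagonal :: "nat \<Rightarrow> 'b \<Rightarrow> 'b::comm_ring_1 mat" where
  "bidiagonal k t = mat k (k + 1) (\<lambda>(i, j). if j = i then -1 else if j = i + 1 then t else 0)"

definition power_col :: "nat \<Rightarrow> 'b \<Rightarrow> 'b::comm_ring_1 mat" where
  "power_col k t = mat (k + 1) 1 (\<lambda>(i, j). t ^ (k - i))"

definition block_kronecker_at ::
  "nat \<Rightarrow> nat \<Rightarrow> nat \<Rightarrow> nat \<Rightarrow> 'b \<Rightarrow> 'b mat \<Rightarrow> 'b::comm_ring_1 mat" where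
  "block_kronecker_at e n h m t M = four_block_mat
     M (transpose_mat (bidiagonal h t) \<otimes>\<^sub>m 1\<^sub>m m)
     (bidiagonal e t \<otimes>\<^sub>m 1\<^sub>m n) (0\<^sub>m (e * n) (h * m))"

definition contraction_at ::
  "nat \<Rightarrow> nat \<Rightarrow> nat \<Rightarrow> nat \<Rightarrow> 'b \<Rightarrow> 'b mat \<Rightarrow> 'b::comm_ring_1 mat" where
  "contraction_at e n h m t M =
     (transpose_mat (power_col h t) \<otimes>\<^sub>m 1\<^sub>m m) * M * (power_col e t \<otimes>\<^sub>m 1\<^sub>m n)"

lemma bidiagonal_carrier [simp]: "bidiagonal k t \<in> carrier_mat k (k + 1)"
  by (simp add: bidiagonal_def)

lemma power_col_carrier [simp]: "power_col k t \<in> carrier_mat (k + 1) 1"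
  by (simp add: power_col_def)

lemma kronecker_one_carrier [simp]:
  "A \<in> carrier_mat r c \<Longrightarrow> A \<otimes>\<^sub>m 1\<^sub>m n \<in> carrier_mat (r * n) (c * n)"
  by (auto simp: kronecker_prod_def)

lemma bidiagonal_kronecker_carrier:
  "bidiagonal k t \<otimes>\<^sub>m 1\<^sub>m n \<in> carrier_mat (k * n) ((k + 1) * n)"
  "transpose_mat (bidiagonal k t) \<otimes>\<^sub>m 1\<^sub>m n \<in> carrier_mat ((k + 1) * n) (k * n)"
  by (intro kronecker_one_carrier; simp add: bidiagonal_def)+

lemma power_col_kronecker_carrier:
  "power_col k t \<otimes>\<^sub>m 1\<^sub>m n \<in> carrier_mat ((k + 1) * n) n"
  "transpose_mat (power_col k t) \<otimes>\<^sub>m 1\<^sub>m n \<in> carrier_mat n ((k + 1) * n)"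
  using kronecker_one_carrier[of "power_col k t" "k + 1" 1 n]
    kronecker_one_carrier[of "transpose_mat (power_col k t)" 1 "k + 1" n]
  by (simp_all add: power_col_def)

lemma bidiagonal_mult_vec:
  fixes t :: "'b::comm_ring_1"
  assumes "u \<in> carrier_vec ((k + 1) * n)" "i < k" "a < n"
  shows "((bidiagonal k t \<otimes>\<^sub>m 1\<^sub>m n) *\<^sub>v u) $ (i * n + a) =
    t * u $ ((i + 1) * n + a) - u $ (i * n + a)"
proof -
  have "(\<Sum>j<k + 1. bidiagonal k t $$ (i, j) * u $ (j * n + a)) =
     (\<Sum>j<k + 1. (if j = i then - u $ (i * n + a) else 0) +
       (if j = i + 1 then t * u $ ((i + 1) * n + a) else 0))"
    using assms by (intro sum.cong) (auto simp: bidiagonal_def)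
  then show ?thesis
    using assms by (subst kronecker_one_mult_vec[OF bidiagonal_carrier])
      (simp_all add: sum.distrib del: sum.lessThan_Suc)
qed

lemma bidiagonal_transpose_mult_vec:
  fixes t :: "'b::comm_ring_1"
  assumes "v \<in> carrier_vec (k * n)" "i < k + 1" "a < n"
  shows "((transpose_mat (bidiagonal k t) \<otimes>\<^sub>m 1\<^sub>m n) *\<^sub>v v) $ (i * n + a) =
    (if i = 0 then 0 else t * v $ ((i - 1) * n + a)) - (if i < k then v $ (i * n + a) else 0)"
proof -
  have "(\<Sum>j<k. transpose_mat (bidiagonal k t) $$ (i, j) * v $ (j * n + a)) =
     (\<Sum>j<k. (if j = i then - v $ (i * n + a) else 0) +
       (if i \<noteq> 0 \<and> j = i - 1 then t * v $ ((i - 1) * n + a) else 0))"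
    using assms by (intro sum.cong) (auto simp: bidiagonal_def)
  also have "\<dots> = (\<Sum>j<k. if j = i then - v $ (i * n + a) else 0) +
       (if i = 0 then 0 else \<Sum>j<k. if j = i - 1 then t * v $ ((i - 1) * n + a) else 0)"
    by (simp add: sum.distrib)
  finally show ?thesis
    using assms by (subst kronecker_one_mult_vec[where r = "k + 1" and c = k]) (auto simp: bidiagonal_def)
qed

lemma power_col_mult_vec:
  fixes t :: "'b::comm_ring_1"
  assumes "x \<in> carrier_vec n" "i < k + 1" "a < n"
  shows "((power_col k t \<otimes>\<^sub>m 1\<^sub>m n) *\<^sub>v x) $ (i * n + a) = t ^ (k - i) * x $ a"
  using assms by (subst kronecker_one_mult_vec[OF power_col_carrier]) (simp_all add: power_col_def)

lemma power_col_transpose_mult_vec: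
  fixes t :: "'b::comm_ring_1"
  assumes "w \<in> carrier_vec ((k + 1) * n)" "a < n"
  shows "((transpose_mat (power_col k t) \<otimes>\<^sub>m 1\<^sub>m n) *\<^sub>v w) $ a =
    (\<Sum>r\<le>k. t ^ (k - r) * w $ (r * n + a))"
proof -
  have "((transpose_mat (power_col k t) \<otimes>\<^sub>m 1\<^sub>m n) *\<^sub>v w) $ (0 * n + a) =
    (\<Sum>r<k + 1. transpose_mat (power_col k t) $$ (0, r) * w $ (r * n + a))"
    using assms by (intro kronecker_one_mult_vec[where r = 1]) (auto simp: power_col_def)
  also have "\<dots> = (\<Sum>r\<le>k. t ^ (k - r) * w $ (r * n + a))"
    by (intro sum.cong) (auto simp: power_col_def)
  finally show ?thesis by simp
qed

text \<open>The left-hand side is membership of \<open>u\<close> in the kernel of \<open>bidiagonal e t\<close>, and the right-hand side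
  says that \<open>u\<close> is a multiple of \<open>power_col e t\<close>.\<close>

lemma geometric_recursion_iff:
  fixes u :: "nat \<Rightarrow> 'b::comm_ring_1"
  shows "(\<forall>i<e. t * u (i + 1) - u i = 0) \<longleftrightarrow> (\<forall>i\<le>e. u i = t ^ (e - i) * u e)"
proof (safe)
  fix i assume rec: "\<forall>i<e. t * u (i + 1) - u i = 0" and "i \<le> e"
  from \<open>i \<le> e\<close> show "u i = t ^ (e - i) * u e"
  proof (induction i rule: inc_induct)
    case (step i)
    then have "e - i = Suc (e - Suc i)" by simp
    moreover have "u i = t * u (Suc i)" using step.hyps rec by simp
    ultimately show ?case using step.IH by (simp add: mult.assoc)
  qed simp
next
  fix i assume *: "\<forall>i\<le>e. u i = t ^ (e - i) * u e" and "i < e"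
  have "e - i = Suc (e - Suc i)" using \<open>i < e\<close> by simp
  with *[rule_format, of i] *[rule_format, of "Suc i"] \<open>i < e\<close>
  have "u i = t * u (Suc i)" by (simp add: mult.assoc)
  then show "t * u (i + 1) - u i = 0" by simp
qed

lemma horner_sum_Suc:
  fixes w :: "nat \<Rightarrow> 'b::comm_ring_1"
  shows "(\<Sum>r\<le>Suc i. t ^ (Suc i - r) * w r) = w (Suc i) + t * (\<Sum>r\<le>i. t ^ (i - r) * w r)"
  by (auto simp: sum_distrib_left Suc_diff_le mult.assoc intro!: sum.cong)

text \<open>The equations \<open>w + transpose_mat (bidiagonal h t) v = 0\<close>, read row by row, compute \<open>v\<close> by Horner
  evaluation of \<open>w\<close> without any division; the last row, where no \<open>v i\<close> is left, says that the
  complete Horner sum vanishes.\<close>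

lemma horner_recursion_iff:
  fixes v w :: "nat \<Rightarrow> 'b::comm_ring_1" and t :: 'b
  defines "S \<equiv> \<lambda>i. \<Sum>r\<le>i. t ^ (i - r) * w r"
  shows "(\<forall>i<h + 1. w i + ((if i = 0 then 0 else t * v (i - 1)) - (if i < h then v i else 0)) = 0)
    \<longleftrightarrow> (\<forall>i<h. v i = S i) \<and> S h = 0"
proof -
  let ?E = "\<lambda>i. w i + ((if i = 0 then 0 else t * v (i - 1)) - (if i < h then v i else 0))"
  \<comment> \<open>As long as the previous \<open>v\<close> is a Horner sum, equation \<open>i\<close> says \<open>v i = S i\<close>.\<close>
  have E: "?E i = S i - (if i < h then v i else 0)" if "i \<noteq> 0 \<Longrightarrow> v (i - 1) = S (i - 1)" for i
    using that horner_sum_Suc[of t "i - 1" w] by (cases i) (simp_all add: S_def)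
  show ?thesis
  proof
    assume eqs: "\<forall>i<h + 1. ?E i = 0"
    have "v i = S i" if "i < h" for i
      using that
    proof (induction i)
      case 0
      then show ?case using E[of 0] eqs[rule_format, of 0] by simp
    next
      case (Suc i)
      then show ?case using E[of "Suc i"] eqs[rule_format, of "Suc i"] by (simp add: add_diff_eq)
    qed
    moreover from this have "S h = 0" using E[of h] eqs[rule_format, of h] by simp
    ultimately show "(\<forall>i<h. v i = S i) \<and> S h = 0" by blast
  next
    assume *: "(\<forall>i<h. v i = S i) \<and> S h = 0"
    show "\<forall>i<h + 1. ?E i = 0"
    proof (intro allI impI)
      fix i assume i: "i < h + 1"
      then have "?E i = S i - (if i < h then v i else 0)"
        using * by (intro E) auto
      also have "\<dots> = 0" using * i by (auto simp: less_Suc_eq)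
      finally show "?E i = 0" .
    qed
  qed
qed

section \<open>The kernel of a block Kronecker matrix\<close>

lemma block_kronecker_at_carrier:
  "M \<in> carrier_mat ((h + 1) * m) ((e + 1) * n) \<Longrightarrow>
   block_kronecker_at e n h m t M \<in> carrier_mat ((h + 1) * m + e * n) ((e + 1) * n + h * m)"
  unfolding block_kronecker_at_def by (rule four_block_carrier_mat) simp_all

lemma contraction_at_carrier:
  "M \<in> carrier_mat ((h + 1) * m) ((e + 1) * n) \<Longrightarrow> contraction_at e n h m t M \<in> carrier_mat m n"
  unfolding contraction_at_def
  by (rule mult_carrier_mat[OF mult_carrier_mat[OF power_col_kronecker_carrier(2)]
        power_col_kronecker_carrier(1)])

definition last_block :: "nat \<Rightarrow> nat \<Rightarrow> 'b vec \<Rightarrow> 'b vec" where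
  "last_block e n z = vec n (\<lambda>a. z $ (e * n + a))"

text \<open>The inverse of \<open>last_block\<close> between the two kernels: the only vector with last block \<open>x\<close> that can
  solve the block equations.  The sums are those of \<open>horner_recursion_iff\<close>, for the blocks of \<open>w\<close>.\<close>

definition kernel_lift ::
  "nat \<Rightarrow> nat \<Rightarrow> nat \<Rightarrow> nat \<Rightarrow> 'b \<Rightarrow> 'b mat \<Rightarrow> 'b vec \<Rightarrow> 'b::comm_ring_1 vec" where
  "kernel_lift e n h m t M x =
     (let u = (power_col e t \<otimes>\<^sub>m 1\<^sub>m n) *\<^sub>v x; w = M *\<^sub>v u
      in u @\<^sub>v vec (h * m) (\<lambda>j. \<Sum>r\<le>j div m. t ^ (j div m - r) * w $ (r * m + j mod m)))"

lemma kernel_lift_carrier [simp]: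
  assumes "x \<in> carrier_vec n"
  shows "kernel_lift e n h m t M x \<in> carrier_vec ((e + 1) * n + h * m)"
proof -
  have "(power_col e t \<otimes>\<^sub>m 1\<^sub>m n) *\<^sub>v x \<in> carrier_vec ((e + 1) * n)"
    using power_col_kronecker_carrier(1) assms by (rule mult_mat_vec_carrier)
  then show ?thesis by (simp add: kernel_lift_def Let_def)
qed

lemma block_kronecker_at_mult_append:
  assumes "M \<in> carrier_mat ((h + 1) * m) ((e + 1) * n)"
    and "u \<in> carrier_vec ((e + 1) * n)" "v \<in> carrier_vec (h * m)"
  shows "block_kronecker_at e n h m t M *\<^sub>v (u @\<^sub>v v) =
    (M *\<^sub>v u + (transpose_mat (bidiagonal h t) \<otimes>\<^sub>m 1\<^sub>m m) *\<^sub>v v) @\<^sub>v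
    (bidiagonal e t \<otimes>\<^sub>m 1\<^sub>m n) *\<^sub>v u"
proof -
  note B = bidiagonal_kronecker_carrier(2)[of h t m] and C = bidiagonal_kronecker_carrier(1)[of e t n]
  have "0\<^sub>m (e * n) (h * m) *\<^sub>v v = 0\<^sub>v (e * n)" using assms(3) by auto
  then show ?thesis
    using four_block_mat_mult_vec[OF assms(1) B C zero_carrier_mat assms(2,3)] C assms(2)
    by (simp add: block_kronecker_at_def)
qed

text \<open>The bottom block row determines \<open>u\<close> from its last block, and the top block row determines \<open>v\<close>
  from \<open>u\<close>.  The one remaining condition is the vanishing of the complete Horner sums of \<open>M *\<^sub>v u\<close>.\<close>

lemma block_kronecker_at_kernel_iff:
  fixes t :: "'b::comm_ring_1"
  assumes M: "M \<in> carrier_mat ((h + 1) * m) ((e + 1) * n)"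
    and u: "u \<in> carrier_vec ((e + 1) * n)" and v: "v \<in> carrier_vec (h * m)"
  shows "block_kronecker_at e n h m t M *\<^sub>v (u @\<^sub>v v) = 0\<^sub>v ((h + 1) * m + e * n) \<longleftrightarrow>
    (\<forall>a<n. \<forall>i\<le>e. u $ (i * n + a) = t ^ (e - i) * u $ (e * n + a)) \<and>
    (\<forall>a<m. (\<forall>i<h. v $ (i * m + a) = (\<Sum>r\<le>i. t ^ (i - r) * (M *\<^sub>v u) $ (r * m + a))) \<and>
           (\<Sum>r\<le>h. t ^ (h - r) * (M *\<^sub>v u) $ (r * m + a)) = 0)"
    (is "_ \<longleftrightarrow> ?U \<and> ?V")
proof -
  let ?B = "transpose_mat (bidiagonal h t) \<otimes>\<^sub>m 1\<^sub>m m"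
  let ?C = "bidiagonal e t \<otimes>\<^sub>m 1\<^sub>m n"
  note B = bidiagonal_kronecker_carrier(2)[of h t m] and C = bidiagonal_kronecker_carrier(1)[of e t n]
  have Mu: "M *\<^sub>v u \<in> carrier_vec ((h + 1) * m)" and Bv: "?B *\<^sub>v v \<in> carrier_vec ((h + 1) * m)"
    and Cu: "?C *\<^sub>v u \<in> carrier_vec (e * n)"
    using M u B v C by (auto intro: mult_mat_vec_carrier)
  have "0\<^sub>v ((h + 1) * m + e * n) = 0\<^sub>v ((h + 1) * m) @\<^sub>v (0\<^sub>v (e * n) :: 'b vec)" by auto
  then have "block_kronecker_at e n h m t M *\<^sub>v (u @\<^sub>v v) = 0\<^sub>v ((h + 1) * m + e * n) \<longleftrightarrow>
      M *\<^sub>v u + ?B *\<^sub>v v = 0\<^sub>v ((h + 1) * m) \<and> ?C *\<^sub>v u = 0\<^sub>v (e * n)"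
    unfolding block_kronecker_at_mult_append[OF M u v]
    using append_vec_eq[OF add_carrier_vec[OF Mu Bv] zero_carrier_vec] by metis
  also have "?C *\<^sub>v u = 0\<^sub>v (e * n) \<longleftrightarrow> (\<forall>j<e * n. (?C *\<^sub>v u) $ j = 0)"
    using carrier_vecD[OF Cu] by (auto simp: vec_eq_iff)
  also have "\<dots> \<longleftrightarrow> (\<forall>a<n. \<forall>i<e. t * u $ ((i + 1) * n + a) - u $ (i * n + a) = 0)"
    unfolding all_less_mult_blocks using bidiagonal_mult_vec[OF u] by auto
  also have "\<dots> \<longleftrightarrow> ?U"
    using geometric_recursion_iff[of e t "\<lambda>i. u $ (i * n + a)" for a] by simp
  also have "M *\<^sub>v u + ?B *\<^sub>v v = 0\<^sub>v ((h + 1) * m) \<longleftrightarrow>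
      (\<forall>j<(h + 1) * m. (M *\<^sub>v u) $ j + (?B *\<^sub>v v) $ j = 0)"
    using carrier_vecD[OF Mu] carrier_vecD[OF Bv] by (auto simp: vec_eq_iff)
  also have "\<dots> \<longleftrightarrow> (\<forall>a<m. \<forall>i<h + 1. (M *\<^sub>v u) $ (i * m + a) +
      ((if i = 0 then 0 else t * v $ ((i - 1) * m + a)) - (if i < h then v $ (i * m + a) else 0)) = 0)"
    unfolding all_less_mult_blocks using bidiagonal_transpose_mult_vec[OF v] by auto
  also have "\<dots> \<longleftrightarrow> ?V"
    using horner_recursion_iff[of h "\<lambda>i. (M *\<^sub>v u) $ (i * m + a)" t "\<lambda>i. v $ (i * m + a)" for a]
    by simp
  finally show ?thesis by blast
qed

text \<open>The condition on the right is the one left over in \<open>block_kronecker_at_kernel_iff\<close> once \<open>u\<close> and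
  \<open>v\<close> have been determined from \<open>x\<close>.\<close>

lemma contraction_at_kernel_iff:
  fixes t :: "'b::comm_ring_1"
  assumes M: "M \<in> carrier_mat ((h + 1) * m) ((e + 1) * n)" and x: "x \<in> carrier_vec n"
  shows "contraction_at e n h m t M *\<^sub>v x = 0\<^sub>v m \<longleftrightarrow>
    (\<forall>a<m. (\<Sum>r\<le>h. t ^ (h - r) * (M *\<^sub>v ((power_col e t \<otimes>\<^sub>m 1\<^sub>m n) *\<^sub>v x)) $ (r * m + a)) = 0)"
proof -
  let ?R = "power_col e t \<otimes>\<^sub>m 1\<^sub>m n" and ?L = "transpose_mat (power_col h t) \<otimes>\<^sub>m 1\<^sub>m m"
  note R = power_col_kronecker_carrier(1)[of e t n] and L = power_col_kronecker_carrier(2)[of h t m]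
  have Rx: "?R *\<^sub>v x \<in> carrier_vec ((e + 1) * n)" using R x by (rule mult_mat_vec_carrier)
  have w: "M *\<^sub>v (?R *\<^sub>v x) \<in> carrier_vec ((h + 1) * m)" using M Rx by (rule mult_mat_vec_carrier)
  have "contraction_at e n h m t M *\<^sub>v x = ?L *\<^sub>v (M *\<^sub>v (?R *\<^sub>v x))"
    unfolding contraction_at_def
    using assoc_mult_mat_vec[OF mult_carrier_mat[OF L M] R x] assoc_mult_mat_vec[OF L M Rx] by simp
  moreover have "?L *\<^sub>v (M *\<^sub>v (?R *\<^sub>v x)) = 0\<^sub>v m \<longleftrightarrow>
      (\<forall>a<m. (?L *\<^sub>v (M *\<^sub>v (?R *\<^sub>v x))) $ a = 0)"
    using carrier_vecD[OF mult_mat_vec_carrier[OF L w]]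
    by (auto simp: vec_eq_iff simp del: index_mult_mat_vec dim_mult_mat_vec)
  ultimately show ?thesis using power_col_transpose_mult_vec[OF w] by simp
qed

lemma last_block_kernel_lift:
  assumes "x \<in> carrier_vec n"
  shows "last_block e n (kernel_lift e n h m t M x) = x"
proof
  fix a assume "a < dim_vec x"
  then have a: "a < n" using assms by simp
  have "e * n + a < (e + 1) * n" using block_index_less[of e "e + 1" a n] a by simp
  moreover have "dim_vec ((power_col e t \<otimes>\<^sub>m 1\<^sub>m n) *\<^sub>v x) = (e + 1) * n"
    using power_col_kronecker_carrier(1)[of e t n] by auto
  ultimately show "last_block e n (kernel_lift e n h m t M x) $ a = x $ a"
    using a power_col_mult_vec[OF assms, of e e a t]
    by (simp add: last_block_def kernel_lift_def Let_def del: index_mult_mat_vec dim_mult_mat_vec)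
qed (use assms in \<open>simp add: last_block_def\<close>)

lemma block_vec_eqI:
  assumes "v \<in> carrier_vec (k * n)" "w \<in> carrier_vec (k * n)"
    and "\<And>i a. i < k \<Longrightarrow> a < n \<Longrightarrow> v $ (i * n + a) = w $ (i * n + a)"
  shows "v = w"
  using assms all_less_mult_blocks[of k n "\<lambda>j. v $ j = w $ j"] by (auto simp: vec_eq_iff)

lemma kernel_lift_in_kernel:
  fixes t :: "'b::comm_ring_1"
  assumes M: "M \<in> carrier_mat ((h + 1) * m) ((e + 1) * n)" and x: "x \<in> carrier_vec n"
    and ker: "contraction_at e n h m t M *\<^sub>v x = 0\<^sub>v m"
  shows "block_kronecker_at e n h m t M *\<^sub>v kernel_lift e n h m t M x = 0\<^sub>v ((h + 1) * m + e * n)"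
proof -
  let ?u = "(power_col e t \<otimes>\<^sub>m 1\<^sub>m n) *\<^sub>v x"
  have u: "?u \<in> carrier_vec ((e + 1) * n)"
    using power_col_kronecker_carrier(1) x by (rule mult_mat_vec_carrier)
  have "?u $ (i * n + a) = t ^ (e - i) * ?u $ (e * n + a)" if "i \<le> e" "a < n" for i a
    using that x power_col_mult_vec[OF x, of _ e a t] by simp
  moreover
  let ?v = "vec (h * m) (\<lambda>j. \<Sum>r\<le>j div m. t ^ (j div m - r) * (M *\<^sub>v ?u) $ (r * m + j mod m))"
  have "?v $ (i * m + a) = (\<Sum>r\<le>i. t ^ (i - r) * (M *\<^sub>v ?u) $ (r * m + a))" if "i < h" "a < m" for i a
    using that block_index_less[of i h a m] by simp
  ultimately show ?thesis
    unfolding kernel_lift_def Let_def block_kronecker_at_kernel_iff[OF M u vec_carrier]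
    using ker[unfolded contraction_at_kernel_iff[OF M x]] by blast
qed

text \<open>Since the equations of \<open>block_kronecker_at_kernel_iff\<close> are equivalences, a kernel vector is
  recovered from its last block of width \<open>n\<close>.\<close>

lemma block_kronecker_at_kernelD:
  fixes t :: "'b::comm_ring_1"
  assumes M: "M \<in> carrier_mat ((h + 1) * m) ((e + 1) * n)"
    and z: "z \<in> carrier_vec ((e + 1) * n + h * m)"
    and ker: "block_kronecker_at e n h m t M *\<^sub>v z = 0\<^sub>v ((h + 1) * m + e * n)"
  shows "z = kernel_lift e n h m t M (last_block e n z)"
    and "contraction_at e n h m t M *\<^sub>v last_block e n z = 0\<^sub>v m"
proof -
  define u where "u = vec_first z ((e + 1) * n)"
  define v where "v = vec_last z (h * m)"
  let ?x = "last_block e n z"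
  have uv: "u \<in> carrier_vec ((e + 1) * n)" "v \<in> carrier_vec (h * m)" "z = u @\<^sub>v v"
    using z by (simp_all add: u_def v_def)
  note * = ker[unfolded uv(3) block_kronecker_at_kernel_iff[OF M uv(1,2)]]
  have u_blocks: "u $ (i * n + a) = t ^ (e - i) * u $ (e * n + a)" if "i \<le> e" "a < n" for i a
    using * that by blast
  have v_blocks: "v $ (i * m + a) = (\<Sum>r\<le>i. t ^ (i - r) * (M *\<^sub>v u) $ (r * m + a))"
    if "i < h" "a < m" for i a
    using * that by blast
  have x: "?x \<in> carrier_vec n" by (simp add: last_block_def)
  have xa: "?x $ a = u $ (e * n + a)" if "a < n" for a
    using that uv block_index_less[of e "e + 1" a n] by (simp add: last_block_def)
  have "(power_col e t \<otimes>\<^sub>m 1\<^sub>m n) *\<^sub>v ?x \<in> carrier_vec ((e + 1) * n)"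
    using power_col_kronecker_carrier(1) x by (rule mult_mat_vec_carrier)
  then have u_eq: "u = (power_col e t \<otimes>\<^sub>m 1\<^sub>m n) *\<^sub>v ?x"
  proof (rule block_vec_eqI[OF uv(1)])
    fix i a assume "i < e + 1" "a < n"
    with u_blocks[of i a] show "u $ (i * n + a) = ((power_col e t \<otimes>\<^sub>m 1\<^sub>m n) *\<^sub>v ?x) $ (i * n + a)"
      using xa power_col_mult_vec[OF x, of i e a t] by simp
  qed
  show "contraction_at e n h m t M *\<^sub>v ?x = 0\<^sub>v m"
    using * unfolding contraction_at_kernel_iff[OF M x] u_eq[symmetric] by blast
  have "v = vec (h * m) (\<lambda>j. \<Sum>r\<le>j div m. t ^ (j div m - r) * (M *\<^sub>v u) $ (r * m + j mod m))"
    using uv v_blocks block_index_less by (intro block_vec_eqI[of _ h m]) auto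
  then show "z = kernel_lift e n h m t M ?x"
    unfolding kernel_lift_def Let_def u_eq[symmetric] using uv by simp
qed

lemma kernel_lift_mem_kernel:
  fixes t :: "'b::comm_ring_1"
  assumes M: "M \<in> carrier_mat ((h + 1) * m) ((e + 1) * n)"
    and x: "x \<in> mat_kernel (contraction_at e n h m t M)"
  shows "kernel_lift e n h m t M x \<in> mat_kernel (block_kronecker_at e n h m t M)"
    and "last_block e n (kernel_lift e n h m t M x) = x"
proof -
  note * = mat_kernelD[OF contraction_at_carrier[OF M] x]
  show "kernel_lift e n h m t M x \<in> mat_kernel (block_kronecker_at e n h m t M)"
    by (rule mat_kernelI[OF block_kronecker_at_carrier[OF M] kernel_lift_carrier[OF *(1)]
          kernel_lift_in_kernel[OF M *]])
  show "last_block e n (kernel_lift e n h m t M x) = x"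
    by (rule last_block_kernel_lift[OF *(1)])
qed

lemma last_block_mem_kernel:
  fixes t :: "'b::comm_ring_1"
  assumes M: "M \<in> carrier_mat ((h + 1) * m) ((e + 1) * n)"
    and z: "z \<in> mat_kernel (block_kronecker_at e n h m t M)"
  shows "last_block e n z \<in> mat_kernel (contraction_at e n h m t M)"
    and "kernel_lift e n h m t M (last_block e n z) = z"
proof -
  note * = block_kronecker_at_kernelD[OF M mat_kernelD[OF block_kronecker_at_carrier[OF M] z]]
  show "last_block e n z \<in> mat_kernel (contraction_at e n h m t M)"
    using *(2) by (intro mat_kernelI[OF contraction_at_carrier[OF M]]) (simp_all add: last_block_def)
  show "kernel_lift e n h m t M (last_block e n z) = z" using *(1) by simp
qed

section \<open>The degree shift\<close>

lemma vec_degree_le_iff: "vec_degree v \<le> d \<longleftrightarrow> (\<forall>i<dim_vec v. degree (v $ i) \<le> d)"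
proof -
  have "finite {degree (v $ i) |i. i < dim_vec v}" by simp
  then show ?thesis unfolding vec_degree_def by (subst Max_le_iff) auto
qed

lemma degree_le_vec_degree: "i < dim_vec v \<Longrightarrow> degree (v $ i) \<le> vec_degree v"
  using vec_degree_le_iff[of v "vec_degree v"] by simp

text \<open>The zero polynomial has degree \<open>0\<close>, so a nonzero entry has to be selected separately when the
  degree of the vector is \<open>0\<close>.\<close>

lemma vec_degree_attained:
  fixes x :: "'a::field poly vec"
  assumes x: "x \<in> carrier_vec n" and "x \<noteq> 0\<^sub>v n"
  obtains a where "a < n" "x $ a \<noteq> 0" "degree (x $ a) = vec_degree x"
proof (cases "vec_degree x = 0")
  case True
  from assms obtain a where a: "a < n" "x $ a \<noteq> 0" by (auto simp: vec_eq_iff)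
  with True x degree_le_vec_degree[of a x] that[of a] show ?thesis by simp
next
  case False
  have "vec_degree x \<in> insert 0 {degree (x $ i) |i. i < dim_vec x}"
    unfolding vec_degree_def by (rule Max_in) auto
  with False x obtain a where "a < n" "degree (x $ a) = vec_degree x" by auto
  with False that[of a] show ?thesis by fastforce
qed

lemma degree_monom_one_mult:
  "p \<noteq> 0 \<Longrightarrow> degree (monom 1 k * p) = k + degree (p :: 'a::field poly)"
  by (simp add: degree_mult_eq degree_monom_eq)

lemma degree_monom_one_mult_le: "degree (monom 1 k * p) \<le> k + degree (p :: 'a::field poly)"
  using degree_mult_le[of "monom 1 k" p] by (simp add: degree_monom_eq)

text \<open>Bounding the Horner sums \<open>S i\<close> from the first one upwards would give a degree that grows with
  \<open>i\<close>.  Because the complete sum vanishes, the recursion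
  \<open>monom 1 l * S i = S (Suc i) - w (Suc i)\<close> can be run downwards from \<open>S h = 0\<close> instead, and every
  \<open>S i\<close> has degree at least \<open>l\<close> below the bound for \<open>w\<close>.\<close>

lemma degree_horner_quotients_le:
  fixes w :: "nat \<Rightarrow> 'a::field poly" and l :: nat
  defines "S \<equiv> \<lambda>i. \<Sum>r\<le>i. monom 1 l ^ (i - r) * w r"
  assumes S: "S h = 0" and w: "\<And>r. r \<le> h \<Longrightarrow> degree (w r) \<le> D + l" and "i < h"
  shows "degree (S i) \<le> D"
proof -
  have "i \<le> h" using \<open>i < h\<close> by simp
  then show ?thesis
  proof (induction i rule: inc_induct)
    case base
    show ?case using S by simp
  next
    case (step i)
    have "monom 1 l * S i = S (Suc i) - w (Suc i)"
      unfolding S_def horner_sum_Suc by simp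
    also have "degree \<dots> \<le> D + l"
      using step w[of "Suc i"] by (intro degree_diff_le) auto
    finally show ?case
      using degree_monom_one_mult[of "S i" l] by (cases "S i = 0") auto
  qed
qed

lemma has_grade_imp_degree_le:
  assumes "has_grade g P" "i < dim_row P" "j < dim_col P"
  shows "degree (P $$ (i, j)) \<le> g"
proof -
  from assms(1) obtain C where
    P: "P = mat (dim_row P) (dim_col P) (\<lambda>rc. \<Sum>k\<le>g. monom (C k $$ rc) k)"
    by (auto simp: has_grade_def)
  have "P $$ (i, j) = (\<Sum>k\<le>g. monom (C k $$ (i, j)) k)"
    using assms(2,3) by (subst P) simp
  also have "degree \<dots> \<le> g"
    by (intro degree_sum_le) (auto intro: order_trans[OF degree_monom_le])
  finally show ?thesis .
qed

lemma degree_mult_mat_vec_le: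
  fixes M :: "'a::field poly mat"
  assumes "has_grade g M" "u \<in> carrier_vec (dim_col M)" "vec_degree u \<le> d" "i < dim_row M"
  shows "degree ((M *\<^sub>v u) $ i) \<le> g + d"
proof -
  have "degree (M $$ (i, j) * u $ j) \<le> g + d" if "j < dim_col M" for j
    using has_grade_imp_degree_le[OF assms(1,4) that] assms(2,3) that
      degree_mult_le[of "M $$ (i, j)" "u $ j"]
    unfolding vec_degree_le_iff by fastforce
  then show ?thesis
    using assms(2,4) by (auto simp: scalar_prod_def intro!: degree_sum_le)
qed

text \<open>The first block of \<open>u\<close> is \<open>x\<close> times the \<open>(e * l)\<close>-th power of the variable, which gives the lower
  bound.  All of \<open>u\<close> has at most that degree; the grade of \<open>M\<close> adds at most \<open>l\<close> in \<open>M *\<^sub>v u\<close>, and the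
  Horner sums lose \<open>l\<close> again, so the second part does not exceed the degree of \<open>u\<close>.\<close>

lemma vec_degree_kernel_lift:
  fixes M :: "'a::field poly mat"
  assumes M: "M \<in> carrier_mat ((h + 1) * m) ((e + 1) * n)" and grade: "has_grade l M"
    and x: "x \<in> carrier_vec n" "x \<noteq> 0\<^sub>v n"
    and ker: "contraction_at e n h m (monom 1 l) M *\<^sub>v x = 0\<^sub>v m"
  shows "vec_degree (kernel_lift e n h m (monom 1 l) M x) = e * l + vec_degree x"
proof (rule antisym)
  let ?t = "monom 1 l :: 'a poly" and ?D = "e * l + vec_degree x"
  let ?u = "(power_col e ?t \<otimes>\<^sub>m 1\<^sub>m n) *\<^sub>v x"
  let ?z = "kernel_lift e n h m ?t M x"
  have u: "?u \<in> carrier_vec ((e + 1) * n)"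
    using power_col_kronecker_carrier(1) x(1) by (rule mult_mat_vec_carrier)
  have u_block: "?u $ (i * n + a) = monom 1 (l * (e - i)) * x $ a" if "i < e + 1" "a < n" for i a
    using power_col_mult_vec[OF x(1) that, of ?t] by (simp add: monom_power)
  have "degree (?u $ (i * n + a)) \<le> ?D" if "i < e + 1" "a < n" for i a
  proof -
    have "degree (?u $ (i * n + a)) \<le> l * (e - i) + degree (x $ a)"
      unfolding u_block[OF that] by (rule degree_monom_one_mult_le)
    also have "\<dots> \<le> e * l + vec_degree x"
      using degree_le_vec_degree[of a x] x(1) that by (intro add_mono) (auto simp: mult.commute)
    finally show ?thesis .
  qed
  then have u_deg: "\<forall>j<(e + 1) * n. degree (?u $ j) \<le> ?D"
    unfolding all_less_mult_blocks by blast
  then have "vec_degree ?u \<le> ?D"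
    using carrier_vecD[OF u] by (simp add: vec_degree_le_iff del: index_mult_mat_vec dim_mult_mat_vec)
  then have w: "degree ((M *\<^sub>v ?u) $ j) \<le> ?D + l" if "j < (h + 1) * m" for j
    using degree_mult_mat_vec_le[OF grade, of ?u ?D j] M u that by (simp add: add.commute)
  have v_deg: "degree (\<Sum>r\<le>i. ?t ^ (i - r) * (M *\<^sub>v ?u) $ (r * m + a)) \<le> ?D"
    if "i < h" "a < m" for i a
  proof (rule degree_horner_quotients_le[OF _ _ \<open>i < h\<close>])
    show "(\<Sum>r\<le>h. ?t ^ (h - r) * (M *\<^sub>v ?u) $ (r * m + a)) = 0"
      using ker[unfolded contraction_at_kernel_iff[OF M x(1)]] that by blast
    show "degree ((M *\<^sub>v ?u) $ (r * m + a)) \<le> ?D + l" if "r \<le> h" for r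
      using w block_index_less[of r "h + 1" a m] that \<open>a < m\<close> by simp
  qed
  have "degree (?z $ j) \<le> ?D" if "j < (e + 1) * n + h * m" for j
  proof (cases "j < (e + 1) * n")
    case True
    then show ?thesis
      using u u_deg that by (simp add: kernel_lift_def Let_def del: index_mult_mat_vec dim_mult_mat_vec)
  next
    case False
    define i where "i = j - (e + 1) * n"
    have i: "i < h * m" using False that by (simp add: i_def)
    then have "m > 0" by (cases m) auto
    with i have "i div m < h" "i mod m < m" by (auto simp: div_less_iff_less_mult)
    from v_deg[OF this] show ?thesis
      using u False that i
      by (simp add: kernel_lift_def Let_def i_def del: index_mult_mat_vec dim_mult_mat_vec)
  qed
  then show "vec_degree ?z \<le> ?D"
    using carrier_vecD[OF kernel_lift_carrier[OF x(1)]] by (simp add: vec_degree_le_iff)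
  obtain a where a: "a < n" "x $ a \<noteq> 0" "degree (x $ a) = vec_degree x"
    using vec_degree_attained[OF x] .
  have a_less: "a < (e + 1) * n" using block_index_less[of 0 "e + 1" a n] a(1) by simp
  have "?z $ a = monom 1 (l * e) * x $ a"
    using u_block[of 0 a] a(1) a_less u
    by (simp add: kernel_lift_def Let_def del: index_mult_mat_vec dim_mult_mat_vec)
  then have "degree (?z $ a) = ?D"
    using degree_monom_one_mult[OF a(2)] a(3) by (simp add: mult.commute)
  moreover have "degree (?z $ a) \<le> vec_degree ?z"
    using a_less carrier_vecD[OF kernel_lift_carrier[OF x(1)]]
    by (intro degree_le_vec_degree) simp
  ultimately show "?D \<le> vec_degree ?z" by simp
qed

section \<open>Right minimal bases\<close>

interpretation to_fract_hom: inj_comm_ring_hom to_fract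
  by unfold_locales auto

lemma map_kronecker_one:
  "map_mat to_fract (A \<otimes>\<^sub>m 1\<^sub>m n) = map_mat to_fract A \<otimes>\<^sub>m 1\<^sub>m n"
proof (rule eq_matI)
  fix i j
  assume "i < dim_row (map_mat to_fract A \<otimes>\<^sub>m 1\<^sub>m n)" "j < dim_col (map_mat to_fract A \<otimes>\<^sub>m 1\<^sub>m n)"
  then have ij: "i < dim_row A * n" "j < dim_col A * n" by (simp_all add: kronecker_prod_def)
  then have "n > 0" by (cases n) auto
  with ij show "map_mat to_fract (A \<otimes>\<^sub>m 1\<^sub>m n) $$ (i, j) = (map_mat to_fract A \<otimes>\<^sub>m 1\<^sub>m n) $$ (i, j)"
    by (simp add: kronecker_prod_def div_less_iff_less_mult)
qed (simp_all add: kronecker_prod_def)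

lemma map_bidiagonal: "map_mat to_fract (bidiagonal k t) = bidiagonal k (to_fract t)"
  by (rule eq_matI) (auto simp: bidiagonal_def)

lemma map_power_col: "map_mat to_fract (power_col k t) = power_col k (to_fract t)"
  by (rule eq_matI) (auto simp: power_col_def to_fract_hom.hom_power)

lemma map_block_kronecker_at:
  assumes "M \<in> carrier_mat ((h + 1) * m) ((e + 1) * n)"
  shows "map_mat to_fract (block_kronecker_at e n h m t M) =
    block_kronecker_at e n h m (to_fract t) (map_mat to_fract M)"
  unfolding block_kronecker_at_def
  by (subst map_four_block_mat[OF assms bidiagonal_kronecker_carrier(2,1) zero_carrier_mat])
    (auto simp: map_kronecker_one map_bidiagonal simp flip: map_mat_transpose
      intro!: cong_four_block_mat)

lemma map_contraction_at:
  assumes M: "M \<in> carrier_mat ((h + 1) * m) ((e + 1) * n)"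
  shows "map_mat to_fract (contraction_at e n h m t M) =
    contraction_at e n h m (to_fract t) (map_mat to_fract M)"
  unfolding contraction_at_def
  by (simp only: to_fract_hom.mat_hom_mult[OF mult_carrier_mat[OF power_col_kronecker_carrier(2) M]
        power_col_kronecker_carrier(1)] to_fract_hom.mat_hom_mult[OF power_col_kronecker_carrier(2) M]
      map_kronecker_one map_power_col map_mat_transpose[symmetric])

text \<open>This lets the kernel computation over the ring of polynomials, where degrees make sense, apply to
  the elements of polynomial bases.\<close>

lemma to_fract_mem_kernel_iff:
  fixes A :: "'a::field poly mat"
  shows "map_vec to_fract z \<in> mat_kernel (map_mat to_fract A) \<longleftrightarrow> z \<in> mat_kernel A"
proof (cases "z \<in> carrier_vec (dim_col A)")
  case True
  then have "map_mat to_fract A *\<^sub>v map_vec to_fract z = map_vec to_fract (A *\<^sub>v z)"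
    by (intro to_fract_hom.mult_mat_vec_hom[symmetric, where nr = "dim_row A"]) auto
  moreover have "map_vec to_fract (0\<^sub>v k) = (0\<^sub>v k :: 'a poly fract vec)" for k by auto
  ultimately show ?thesis
    using True map_vec_to_fract_inject[of "A *\<^sub>v z" "0\<^sub>v (dim_row A)"]
    by (simp add: mat_kernel_def)
qed (auto simp: mat_kernel_def)

text \<open>Over the rational functions \<open>last_block\<close> and \<open>kernel_lift\<close> give the linear isomorphism; over the
  polynomials they give the bijection of polynomial vectors, which shifts degrees by \<open>e * l\<close>.\<close>

lemma right_minimal_basis_last_block:
  fixes M :: "'a::field poly mat" and l :: nat
  defines "t \<equiv> monom 1 l :: 'a poly"
  assumes M: "M \<in> carrier_mat ((h + 1) * m) ((e + 1) * n)" and grade: "has_grade l M"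
    and zs: "right_minimal_basis (block_kronecker_at e n h m t M) zs"
  shows "right_minimal_basis (contraction_at e n h m t M) (map (last_block e n) zs)"
proof -
  let ?L = "block_kronecker_at e n h m t M" and ?P = "contraction_at e n h m t M"
  let ?q = "(e + 1) * n + h * m"
  note L = block_kronecker_at_carrier[OF M, of t] and P = contraction_at_carrier[OF M, of t]
  have hM: "map_mat to_fract M \<in> carrier_mat ((h + 1) * m) ((e + 1) * n)" using M by simp
  have carr: "z \<in> carrier_vec ?q" if "z \<in> mat_kernel (map_mat to_fract ?L)" for z
    using that mat_kernelD(1)[of "map_mat to_fract ?L" _ ?q] L by auto
  have block_less: "e * n + a < ?q" if "a < n" for a
    using block_index_less[of e "e + 1" a n] that by simp
  have "minimal_basis n (mat_kernel (map_mat to_fract ?P)) (map (last_block e n) zs)"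
  proof (rule minimal_basis_transfer[OF L P, where F = "last_block e n" and c = "e * l"
        and g = "kernel_lift e n h m t M"])
    show "bij_betw (last_block e n) (mat_kernel (map_mat to_fract ?L)) (mat_kernel (map_mat to_fract ?P))"
      unfolding map_block_kronecker_at[OF M] map_contraction_at[OF M]
      by (rule bij_betw_byWitness[where f' = "kernel_lift e n h m (to_fract t) (map_mat to_fract M)"])
        (use kernel_lift_mem_kernel[OF hM] last_block_mem_kernel[OF hM] in auto)
    show "last_block e n (u + v) = last_block e n u + last_block e n v"
      if "u \<in> mat_kernel (map_mat to_fract ?L)" "v \<in> mat_kernel (map_mat to_fract ?L)" for u v
      using carr[OF that(1)] carr[OF that(2)] block_less by (auto simp: last_block_def)
    show "last_block e n (c \<cdot>\<^sub>v v) = c \<cdot>\<^sub>v last_block e n v"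
      if "v \<in> mat_kernel (map_mat to_fract ?L)" for c v
      using carr[OF that] block_less by (auto simp: last_block_def)
    show "last_block e n (map_vec to_fract z) = map_vec to_fract (last_block e n z)"
      if "z \<in> carrier_vec ?q" for z :: "'a poly vec"
      using that block_less by (auto simp: last_block_def)
    show "kernel_lift e n h m t M x \<in> carrier_vec ?q \<and>
        map_vec to_fract (kernel_lift e n h m t M x) \<in> mat_kernel (map_mat to_fract ?L) \<and>
        last_block e n (kernel_lift e n h m t M x) = x"
      if "map_vec to_fract x \<in> mat_kernel (map_mat to_fract ?P)" for x
      using that kernel_lift_mem_kernel[OF M, of x t] mat_kernelD(1)[OF L]
      unfolding to_fract_mem_kernel_iff by blast
    show "vec_degree z = e * l + vec_degree (last_block e n z)"
      if "map_vec to_fract z \<in> mat_kernel (map_mat to_fract ?L)" "z \<noteq> 0\<^sub>v ?q" for z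
    proof -
      have z: "z \<in> mat_kernel ?L" using that(1) by (simp add: to_fract_mem_kernel_iff)
      note x = last_block_mem_kernel[OF M z]
      have "0\<^sub>v ?q \<in> mat_kernel ?L" using L by (intro mat_kernelI[OF L]) auto
      moreover have "last_block e n (0\<^sub>v ?q) = (0\<^sub>v n :: 'a poly vec)"
        using block_less by (auto simp: last_block_def)
      ultimately have "last_block e n z \<noteq> 0\<^sub>v n"
        using last_block_mem_kernel(2)[OF M] x(2) that(2) by metis
      then show ?thesis
        using vec_degree_kernel_lift[OF M grade mat_kernelD(1)[OF P x(1)]] x(2)
          mat_kernelD(2)[OF P x(1)] by (simp add: t_def)
    qed
    show "minimal_basis ?q (mat_kernel (map_mat to_fract ?L)) zs"
      using zs L by (simp add: right_minimal_basis_def)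
  qed
  then show ?thesis using P by (simp add: right_minimal_basis_def)
qed

section \<open>Left minimal bases by transposition\<close>

lemma transpose_kronecker_one:
  fixes A :: "'b::comm_ring_1 mat"
  shows "transpose_mat (A \<otimes>\<^sub>m 1\<^sub>m n) = transpose_mat A \<otimes>\<^sub>m 1\<^sub>m n"
proof (rule eq_matI)
  fix i j
  assume "i < dim_row (transpose_mat A \<otimes>\<^sub>m 1\<^sub>m n)" "j < dim_col (transpose_mat A \<otimes>\<^sub>m 1\<^sub>m n)"
  then have ij: "i < dim_col A * n" "j < dim_row A * n" by (simp_all add: kronecker_prod_def)
  then have "n > 0" by (cases n) auto
  with ij show "transpose_mat (A \<otimes>\<^sub>m 1\<^sub>m n) $$ (i, j) = (transpose_mat A \<otimes>\<^sub>m 1\<^sub>m n) $$ (i, j)"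
    by (auto simp: kronecker_prod_def div_less_iff_less_mult)
qed (simp_all add: kronecker_prod_def)

lemma left_null_space_eq_kernel_transpose:
  fixes A :: "'b::comm_ring_1 mat"
  shows "left_null_space A = mat_kernel (transpose_mat A)"
proof -
  have "mat_of_row y * A = 0\<^sub>m 1 (dim_col A) \<longleftrightarrow> transpose_mat A *\<^sub>v y = 0\<^sub>v (dim_col A)"
    if "y \<in> carrier_vec (dim_row A)" for y
    using that by (auto simp: mat_eq_iff vec_eq_iff comm_scalar_prod[of y "dim_row A"])
  then show ?thesis by (auto simp: left_null_space_def mat_kernel_def)
qed

lemma left_minimal_basis_iff_transpose:
  "left_minimal_basis A = right_minimal_basis (transpose_mat A)"
  by (simp add: left_minimal_basis_def right_minimal_basis_def left_null_space_eq_kernel_transpose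
      map_mat_transpose)

lemma has_grade_transpose:
  assumes "has_grade g P"
  shows "has_grade g (transpose_mat P)"
proof -
  from assms obtain C where C: "\<And>i. i \<le> g \<Longrightarrow> C i \<in> carrier_mat (dim_row P) (dim_col P)"
    and P: "P = mat (dim_row P) (dim_col P) (\<lambda>rc. \<Sum>i\<le>g. monom (C i $$ rc) i)"
    by (auto simp: has_grade_def)
  have "transpose_mat P = mat (dim_col P) (dim_row P)
      (\<lambda>rc. \<Sum>i\<le>g. monom (transpose_mat (C i) $$ rc) i)"
  proof (rule eq_matI)
    fix i j assume "i < dim_row (mat (dim_col P) (dim_row P)
      (\<lambda>rc. \<Sum>i\<le>g. monom (transpose_mat (C i) $$ rc) i))"
      "j < dim_col (mat (dim_col P) (dim_row P)
      (\<lambda>rc. \<Sum>i\<le>g. monom (transpose_mat (C i) $$ rc) i))"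
    then have ij: "i < dim_col P" "j < dim_row P" by simp_all
    then have "transpose_mat P $$ (i, j) = (\<Sum>k\<le>g. monom (C k $$ (j, i)) k)"
      by (subst P) simp
    also have "\<dots> = (\<Sum>k\<le>g. monom (transpose_mat (C k) $$ (i, j)) k)"
    proof (intro sum.cong refl)
      fix k assume "k \<in> {..g}"
      then show "monom (C k $$ (j, i)) k = monom (transpose_mat (C k) $$ (i, j)) k"
        using ij C[of k] by simp
    qed
    finally show "transpose_mat P $$ (i, j) = mat (dim_col P) (dim_row P)
      (\<lambda>rc. \<Sum>i\<le>g. monom (transpose_mat (C i) $$ rc) i) $$ (i, j)"
      using ij by simp
  qed simp_all
  then show ?thesis
    unfolding has_grade_def using C by (intro exI[of _ "\<lambda>i. transpose_mat (C i)"]) auto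
qed

text \<open>Transposition exchanges the roles of \<open>(e, n)\<close> and \<open>(h, m)\<close>.  With the next lemma, this makes the
  statement on left minimal bases an instance of the one on right minimal bases.\<close>

lemma transpose_block_kronecker_at:
  assumes M: "M \<in> carrier_mat ((h + 1) * m) ((e + 1) * n)"
  shows "transpose_mat (block_kronecker_at e n h m t M) =
    block_kronecker_at h m e n t (transpose_mat M)"
  unfolding block_kronecker_at_def
  by (subst transpose_four_block_mat[OF M bidiagonal_kronecker_carrier(2,1) zero_carrier_mat])
    (simp add: transpose_kronecker_one)

lemma transpose_contraction_at:
  assumes M: "M \<in> carrier_mat ((h + 1) * m) ((e + 1) * n)"
  shows "transpose_mat (contraction_at e n h m t M) = contraction_at h m e n t (transpose_mat M)"
proof -
  let ?X = "transpose_mat (power_col h t) \<otimes>\<^sub>m 1\<^sub>m m" and ?Y = "power_col e t \<otimes>\<^sub>m 1\<^sub>m n"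
  note X = power_col_kronecker_carrier(2)[of h t m] and Y = power_col_kronecker_carrier(1)[of e t n]
  have "transpose_mat (?X * M * ?Y) = transpose_mat ?Y * (transpose_mat M * transpose_mat ?X)"
    using transpose_mult[OF mult_carrier_mat[OF X M] Y] transpose_mult[OF X M] by simp
  also have "\<dots> = transpose_mat ?Y * transpose_mat M * transpose_mat ?X"
    using X Y M by (intro assoc_mult_mat[symmetric]) auto
  finally show ?thesis by (simp add: contraction_at_def transpose_kronecker_one)
qed

section \<open>Block Kronecker matrix polynomials\<close>

lemma at_power_L_pencil: "at_power (L_pencil k) l = bidiagonal k (monom 1 l)"
  by (rule eq_matI) (auto simp: at_power_def L_pencil_def bidiagonal_def pcompose_pCons pcompose_uminus
      pcompose_1)

lemma at_power_Lambda_col: "at_power (Lambda_col k) l = power_col k (monom 1 l)"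
proof -
  have "pcompose (monom 1 i) q = q ^ i" for i and q :: "'a poly"
    by (induction i) (simp_all add: monom_Suc pcompose_pCons pcompose_1 monom_0)
  then show ?thesis
    by (intro eq_matI) (auto simp: at_power_def Lambda_col_def power_col_def)
qed

lemma vec_block_eq_last_block:
  "vec_block (block_col_sizes e n h m) z e = last_block e n z"
  by (simp add: vec_block_def block_col_sizes_def last_block_def nth_append sum_list_replicate
      del: replicate_Suc)

theorem theorem6p6:
  fixes P M L :: "'a::field poly mat"
    and m n d k l \<epsilon> \<eta> :: nat
  assumes "P \<in> carrier_mat m n"
    and "has_grade d P"
    and "singular_poly_mat P"
    and "d = k * l"
    and "block_kronecker \<epsilon> n \<eta> m l M L"
    and "k = \<epsilon> + \<eta> + 1"
    and "P = (transpose_mat (at_power (Lambda_col \<eta>) l) \<otimes>\<^sub>m 1\<^sub>m m) * M *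
             (at_power (Lambda_col \<epsilon>) l \<otimes>\<^sub>m 1\<^sub>m n)"
  shows "(\<forall>zs. right_minimal_basis L zs \<longrightarrow>
            right_minimal_basis P (map (\<lambda>z. vec_block (block_col_sizes \<epsilon> n \<eta> m) z \<epsilon>) zs)) \<and>
         (\<forall>ws. left_minimal_basis L ws \<longrightarrow>
            left_minimal_basis P (map (\<lambda>w. vec_block (block_row_sizes \<epsilon> n \<eta> m) w \<eta>) ws))"
proof -
  let ?t = "monom 1 l :: 'a poly"
  from assms(5) have M: "M \<in> carrier_mat ((\<eta> + 1) * m) ((\<epsilon> + 1) * n)" and grade: "has_grade l M"
    and L: "L = block_kronecker_at \<epsilon> n \<eta> m ?t M"
    by (simp_all add: block_kronecker_def block_kronecker_at_def at_power_L_pencil)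
  have P: "P = contraction_at \<epsilon> n \<eta> m ?t M"
    using assms(7) by (simp add: contraction_at_def at_power_Lambda_col)
  have MT: "transpose_mat M \<in> carrier_mat ((\<epsilon> + 1) * n) ((\<eta> + 1) * m)" using M by simp
  have rows: "vec_block (block_row_sizes \<epsilon> n \<eta> m) w \<eta> = last_block \<eta> m w" for w :: "'a poly vec"
    using vec_block_eq_last_block[of \<eta> m \<epsilon> n w] by (simp add: block_row_sizes_def block_col_sizes_def)
  show ?thesis
    unfolding vec_block_eq_last_block rows left_minimal_basis_iff_transpose
    using right_minimal_basis_last_block[OF M grade]
      right_minimal_basis_last_block[OF MT has_grade_transpose[OF grade]]
    by (simp add: L P transpose_block_kronecker_at[OF M] transpose_contraction_at[OF M])
qed

end
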